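(* Let $\mu,\nu,q\in\mathbb{C}$ and let $X,Y$ be the generators of the $q$-deformed generalized Ore algebra $\mathcal{O}_{\mu,\nu}(q)$. Let $\omega=Y^{n_r}X^{m_r}\cdots Y^{n_1}X^{m_1}$ with $n_j,m_j\in\mathbb{N}_0$, and put $|\mathbf{n}|=n_1+\cdots+n_r$, $|\mathbf{m}|=m_1+\cdots+m_r$. Then in $\mathcal{O}_{\mu,\nu}(q)$ $$\omega=\sum_{k=0}^{\min(|\mathbf{m}|,|\mathbf{n}|)}\ \sum_{\ell=0}^{|\mathbf{m}|-k} m_{k,\ell}(B_\omega;q)\,Y^{|\mathbf{n}|-k}X^{|\mathbf{m}|-k-\ell}.$$
   Context: $\mathcal{O}_{\mu,\nu}(q)$ is the complex unital algebra generated by $X,Y$ subject to $XY-qYX=\mu I+\nu Y$. Board of a word: for a word $\omega$ in $X,Y$, draw the lattice path starting at $(0,0)$ reading $\omega$ from left to right, each $X$ a unit step right and each $Y$ a unit step up. $B_\omega$ is the Ferrers board of unit cells lying above this path, with $x\ge 0$ and below the line $y=$ (number of $Y$'s in $\omega$). Equivalently, columns correspond to the letters $X$ (left to right), rows to the letters $Y$ (the $j$-th $Y$ from the left is the $j$-th row from the bottom), and the column of a given $X$ contains a cell in the row of each $Y$ occurring to the right of that $X$. "Above" means in a higher row. Mixed placements: for a Ferrers board $B$, $\mathcal{M}_{k,\ell}(B)$ is the set of placements of $k$ rooks and $\ell$ files in distinct cells of $B$ which are non-attacking, meaning: no two rooks lie in the same row or column; no two files lie in the same column; no file and rook lie in the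 same column; and no file lies in the same row as a rook and to the left of it. For $\phi\in\mathcal{M}_{k,\ell}(B)$, a cell is a rook box (resp. file box) if it contains a rook (resp. file); it is cancelled if it is neither and it lies above a rook in the same column, or to the left of a rook in the same row, or above a file in the same column; all other cells are empty boxes. The $q$-deformed mixed placement numbers are $$m_{k,\ell}(B;q)=\mu^k\nu^\ell\sum_{\phi\in\mathcal{M}_{k,\ell}(B)}q^{\#\text{empty boxes of }\phi}$$ (the empty placement contributes $q^{|B|}$, $|B|$ the number of cells). *)

theory Defs
  imports
    Complex_Main
    "HOL-Library.Poly_Mapping"
    "HOL-Algebra.Algebraic_Closure_Type"
begin

section \<open>Words and the free algebra on two generators\<close>

text \<open>The letters \<open>X\<close>, \<open>Y\<close>; the bare name \<open>X\<close> is syntax of univariate polynomials in HOL-Algebra.\<close>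

datatype letter = LX | LY

text \<open>
  Words form a monoid under concatenation. Written additively, as \<^typ>\<open>'a \<Rightarrow>\<^sub>0 'b\<close>
  expects of its exponents, this makes finitely supported functions from words to \<open>\<complex>\<close>,
  with the convolution product, the free unital \<open>\<complex>\<close>-algebra on \<open>X\<close>, \<open>Y\<close>.
\<close>

instantiation list :: (type) monoid_add
begin

definition zero_list :: "'a list" where "0 = []"

definition plus_list :: "'a list \<Rightarrow> 'a list \<Rightarrow> 'a list" where "u + v = u @ v"

instance by standard (simp_all add: zero_list_def plus_list_def)

end

type_synonym free_alg = "letter list \<Rightarrow>\<^sub>0 complex"

definition free_gen :: "letter \<Rightarrow> free_alg" where
  "free_gen a = Poly_Mapping.single [a] 1"

definition free_scalar :: "complex \<Rightarrow> free_alg" where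
  "free_scalar c = Poly_Mapping.single [] c"


section \<open>The q-deformed generalized Ore algebra\<close>

definition ore_relator :: "complex \<Rightarrow> complex \<Rightarrow> complex \<Rightarrow> free_alg" where
  "ore_relator mu nu q =
     free_gen LX * free_gen LY
     - (free_scalar q * free_gen LY * free_gen LX + free_scalar mu + free_scalar nu * free_gen LY)"

text \<open>\<open>Idl\<close> is the generated two-sided ideal; its left and right closure are both part of \<^const>\<open>ideal\<close>.\<close>

definition ore_ideal :: "complex \<Rightarrow> complex \<Rightarrow> complex \<Rightarrow> free_alg set" where
  "ore_ideal mu nu q = Idl\<^bsub>ring_of_type_algebra\<^esub> {ore_relator mu nu q}"

definition ore_algebra :: "complex \<Rightarrow> complex \<Rightarrow> complex \<Rightarrow> free_alg set ring" where
  "ore_algebra mu nu q = ring_of_type_algebra Quot (ore_ideal mu nu q)"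

definition ore_class :: "complex \<Rightarrow> complex \<Rightarrow> complex \<Rightarrow> free_alg \<Rightarrow> free_alg set" where
  "ore_class mu nu q p = ore_ideal mu nu q +>\<^bsub>ring_of_type_algebra\<^esub> p"

definition ore_gen :: "complex \<Rightarrow> complex \<Rightarrow> complex \<Rightarrow> letter \<Rightarrow> free_alg set" where
  "ore_gen mu nu q a = ore_class mu nu q (free_gen a)"

text \<open>
  The record \<^const>\<open>ore_algebra\<close> has no scalar multiplication; the \<open>\<complex>\<close>-algebra structure is
  carried by the central elements \<open>c \<cdot> 1\<close>, and \<open>c \<cdot> a\<close> is the product of \<open>c \<cdot> 1\<close> and \<open>a\<close>.
\<close>

definition ore_scalar :: "complex \<Rightarrow> complex \<Rightarrow> complex \<Rightarrow> complex \<Rightarrow> free_alg set" where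
  "ore_scalar mu nu q c = ore_class mu nu q (free_scalar c)"

definition ore_word :: "complex \<Rightarrow> complex \<Rightarrow> complex \<Rightarrow> letter list \<Rightarrow> free_alg set" where
  "ore_word mu nu q w =
     foldr (\<lambda>a p. ore_gen mu nu q a \<otimes>\<^bsub>ore_algebra mu nu q\<^esub> p) w \<one>\<^bsub>ore_algebra mu nu q\<^esub>"

lemma ring_ring_of_type_algebra: "ring (ring_of_type_algebra :: 'a::ring_1 ring)"
proof -
  have "\<exists>y. x + y = 0" for x :: 'a
    using add.right_inverse by blast
  then show ?thesis
    unfolding ring_of_type_algebra_def using add.right_inverse
    by unfold_locales (auto simp: algebra_simps Units_def)
qed

lemma ideal_ore_ideal: "ideal (ore_ideal mu nu q) ring_of_type_algebra"
  unfolding ore_ideal_def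
  by (rule ring.genideal_ideal[OF ring_ring_of_type_algebra])
     (simp add: ring_of_type_algebra_def)

lemma ring_ore_algebra: "ring (ore_algebra mu nu q)"
  unfolding ore_algebra_def by (rule ideal.quotient_is_ring[OF ideal_ore_ideal])

lemma ore_relation:
  fixes mu nu q :: complex
  defines "A \<equiv> ore_algebra mu nu q"
  shows "ore_gen mu nu q LX \<otimes>\<^bsub>A\<^esub> ore_gen mu nu q LY =
    ore_scalar mu nu q q \<otimes>\<^bsub>A\<^esub> ore_gen mu nu q LY \<otimes>\<^bsub>A\<^esub> ore_gen mu nu q LX
    \<oplus>\<^bsub>A\<^esub> ore_scalar mu nu q mu \<oplus>\<^bsub>A\<^esub> ore_scalar mu nu q nu \<otimes>\<^bsub>A\<^esub> ore_gen mu nu q LY"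
proof -
  let ?F = "ring_of_type_algebra :: free_alg ring"
  interpret I: ideal "ore_ideal mu nu q" ?F by (rule ideal_ore_ideal)
  have car: "p \<in> carrier ?F" for p by (simp add: ring_of_type_algebra_def)
  have hom: "ore_class mu nu q \<in> ring_hom ?F A"
    using I.rcos_ring_hom by (simp add: ore_class_def[abs_def] A_def ore_algebra_def)
  have mult: "ore_class mu nu q p \<otimes>\<^bsub>A\<^esub> ore_class mu nu q p' = ore_class mu nu q (p * p')" for p p'
    using ring_hom_mult[OF hom car car, of p p'] by (simp add: ring_of_type_algebra_def)
  have add: "ore_class mu nu q p \<oplus>\<^bsub>A\<^esub> ore_class mu nu q p' = ore_class mu nu q (p + p')" for p p'
    using ring_hom_add[OF hom car car, of p p'] by (simp add: ring_of_type_algebra_def)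
  have "ore_relator mu nu q \<in> ore_ideal mu nu q"
    unfolding ore_ideal_def using I.genideal_self'[OF car] by simp
  then have zero: "ore_class mu nu q (ore_relator mu nu q) = ore_ideal mu nu q"
    unfolding ore_class_def by (rule I.a_rcos_const)
  have "ore_class mu nu q (p + ore_relator mu nu q) = ore_class mu nu q p" for p
  proof -
    interpret Q: ring A unfolding A_def by (rule ring_ore_algebra)
    have "\<zero>\<^bsub>A\<^esub> = ore_ideal mu nu q"
      by (simp add: A_def ore_algebra_def FactRing_def)
    with zero Q.r_zero[OF ring_hom_closed[OF hom car]] show ?thesis
      by (simp flip: add)
  qed
  note this[of "free_scalar q * free_gen LY * free_gen LX + free_scalar mu + free_scalar nu * free_gen LY"]
  then show ?thesis
    by (simp add: ore_gen_def ore_scalar_def mult add ore_relator_def)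
qed


section \<open>Boards and mixed placements\<close>

text \<open>
  A cell is a pair (column, row), both counted from 0, columns from the left and rows from the
  bottom. The \<open>X\<close> at position \<open>s\<close> of \<open>w\<close> and the \<open>Y\<close> at position \<open>t\<close> belong to the column
  and row numbered by the \<open>X\<close>s before \<open>s\<close> and the \<open>Y\<close>s before \<open>t\<close>.
\<close>

type_synonym cell = "nat \<times> nat"

definition board :: "letter list \<Rightarrow> cell set" where
  "board w =
     {(count_list (take s w) LX, count_list (take t w) LY) | s t.
        s < t \<and> t < length w \<and> w ! s = LX \<and> w ! t = LY}"

text \<open>A placement is a pair of the set \<open>R\<close> of rook cells and the set \<open>F\<close> of file cells.\<close>

definition nonattacking :: "cell set \<Rightarrow> cell set \<Rightarrow> bool" where
  "nonattacking R F \<longleftrightarrow>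
     (\<forall>c\<in>R. \<forall>d\<in>R. c \<noteq> d \<longrightarrow> fst c \<noteq> fst d \<and> snd c \<noteq> snd d) \<and>
     (\<forall>c\<in>F. \<forall>d\<in>F. c \<noteq> d \<longrightarrow> fst c \<noteq> fst d) \<and>
     (\<forall>f\<in>F. \<forall>c\<in>R. fst f \<noteq> fst c) \<and>
     (\<forall>f\<in>F. \<forall>c\<in>R. \<not> (snd f = snd c \<and> fst f < fst c))"

definition mixed_placements :: "nat \<Rightarrow> nat \<Rightarrow> cell set \<Rightarrow> (cell set \<times> cell set) set" where
  "mixed_placements k l B =
     {(R, F). R \<subseteq> B \<and> F \<subseteq> B \<and> R \<inter> F = {} \<and> card R = k \<and> card F = l \<and> nonattacking R F}"

definition cancelled :: "cell set \<Rightarrow> cell set \<Rightarrow> cell \<Rightarrow> bool" where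
  "cancelled R F c \<longleftrightarrow> c \<notin> R \<union> F \<and>
     ((\<exists>d\<in>R. fst c = fst d \<and> snd d < snd c) \<or>
      (\<exists>d\<in>R. snd c = snd d \<and> fst c < fst d) \<or>
      (\<exists>d\<in>F. fst c = fst d \<and> snd d < snd c))"

definition empty_boxes :: "cell set \<Rightarrow> cell set \<times> cell set \<Rightarrow> cell set" where
  "empty_boxes B = (\<lambda>(R, F). {c \<in> B. c \<notin> R \<union> F \<and> \<not> cancelled R F c})"

definition mixed_number ::
  "complex \<Rightarrow> complex \<Rightarrow> complex \<Rightarrow> nat \<Rightarrow> nat \<Rightarrow> cell set \<Rightarrow> complex" where
  "mixed_number mu nu q k l B =
     mu ^ k * nu ^ l * (\<Sum>\<phi>\<in>mixed_placements k l B. q ^ card (empty_boxes B \<phi>))"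


section \<open>Words in block form\<close>

text \<open>The word \<open>Y\<^bsup>n r\<^esup> X\<^bsup>m r\<^esup> \<dots> Y\<^bsup>n 1\<^esup> X\<^bsup>m 1\<^esup>\<close>, with block \<open>r\<close> leftmost.\<close>

definition block_word :: "nat \<Rightarrow> (nat \<Rightarrow> nat) \<Rightarrow> (nat \<Rightarrow> nat) \<Rightarrow> letter list" where
  "block_word r n m = concat (map (\<lambda>j. replicate (n j) LY @ replicate (m j) LX) (rev [1..<Suc r]))"

end

theory Submission
  imports Defs
begin

text \<open>
  Induction on the word, read from its last letter to its first.  Prepending \<open>Y\<close> adds an empty
  bottom row to the board and multiplies normally ordered monomials by \<open>Y\<close>.  Prepending \<open>X\<close> adds
  a full leftmost column; here one uses
  \<open>X Y\<^sup>n = q\<^sup>n Y\<^sup>n X + (\<Sum>j<n. q\<^sup>j (\<mu> Y\<^bsup>n-1\<^esup> + \<nu> Y\<^sup>n))\<close>.  With \<open>k\<close> rooks on the old board, exactly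
  \<open>n = N - k\<close> cells of the new column are not cancelled, and the terms are the ways to fill it:
  nothing, or a rook or a file in the uncancelled cell with \<open>j\<close> uncancelled cells below it.
\<close>

section \<open>Boards\<close>

text \<open>The board of \<open>w\<close> with its bottom left corner at \<open>(c, r)\<close>.  The offset lets the board of a
  suffix of a word sit inside the board of the word without translation.\<close>

primrec board_from :: "nat \<Rightarrow> nat \<Rightarrow> letter list \<Rightarrow> cell set" where
  "board_from c r [] = {}"
| "board_from c r (a # w) =
     (case a of
        LX \<Rightarrow> {c} \<times> {r..<r + count_list w LY} \<union> board_from (Suc c) r w
      | LY \<Rightarrow> board_from c (Suc r) w)"

text \<open>Peels off the first letter of a word: either it is the left member of a pair of
  positions, or both positions lie in the tail. As \<open>s < t\<close>, the position
  \<open>t\<close> is a successor in both cases.\<close>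

lemma ex_less_Suc_split:
  "(\<exists>s t. s < t \<and> P s t) \<longleftrightarrow> (\<exists>t. P 0 (Suc t)) \<or> (\<exists>s t. s < t \<and> P (Suc s) (Suc t))"
  (is "?L \<longleftrightarrow> ?R")
proof
  assume ?L
  then obtain s t where "s < t" "P s t" by blast
  then show ?R by (cases s; cases t) auto
next
  assume ?R
  then show ?L by (meson Suc_less_eq zero_less_Suc)
qed

text \<open>Each occurrence of \<open>a\<close> raises the running count by one, so the counts
  before the occurrences run through all values below the total. This makes the column of a leading
  \<open>LX\<close> a full interval of rows.\<close>

lemma ex_count_list_take:
  "(\<exists>t. t < length w \<and> w ! t = a \<and> i = count_list (take t w) a) \<longleftrightarrow> i < count_list w a"
proof (induction w arbitrary: i)
  case Nil
  then show ?case by simp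
next
  case (Cons b w)
  have split: "(\<exists>t. P t) \<longleftrightarrow> P 0 \<or> (\<exists>t. P (Suc t))" for P :: "nat \<Rightarrow> bool"
    by (metis not0_implies_Suc)
  show ?case
  proof (cases "b = a")
    case True
    show ?thesis
    proof (cases i)
      case 0
      then show ?thesis using True by (auto intro!: exI[of _ 0])
    next
      case (Suc i')
      then show ?thesis using True Cons.IH[of i'] by (subst split) simp
    qed
  next
    case False
    then show ?thesis using Cons.IH[of i] by (subst split) simp
  qed
qed

text \<open>Pairs with \<open>s = 0\<close> exist only if the first letter is \<open>LX\<close>, and
  then they form one full column. All other pairs come from the tail, with the column or row offset
  raised by the first letter.\<close>

lemma board_from_eq:
  "board_from c r w =
     {(c + count_list (take s w) LX, r + count_list (take t w) LY) | s t.
        s < t \<and> t < length w \<and> w ! s = LX \<and> w ! t = LY}"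
proof (induction w arbitrary: c r)
  case Nil
  then show ?case by simp
next
  case (Cons a w)
  \<comment> \<open>\<open>P\<close> leaves out \<open>s < t\<close>, so that the split into
    \<open>s = 0\<close> and shifted positions applies to it.\<close>
  define P where "P c r w x s t \<longleftrightarrow>
    x = (c + count_list (take s w) LX, r + count_list (take t w) LY) \<and>
    t < length w \<and> w ! s = LX \<and> w ! t = LY" for c r w and x :: cell and s t
  have IH: "x \<in> board_from c r w \<longleftrightarrow> (\<exists>s t. s < t \<and> P c r w x s t)" for c r x
    unfolding Cons.IH[of c r] P_def by blast
  have "x \<in> board_from c r (a # w) \<longleftrightarrow> (\<exists>s t. s < t \<and> P c r (a # w) x s t)" for x
  proof (cases a)
    case LX
    have "(\<exists>t. P c r (a # w) x 0 (Suc t)) \<longleftrightarrow>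
        fst x = c \<and> r \<le> snd x \<and>
        (\<exists>t. t < length w \<and> w ! t = LY \<and> snd x - r = count_list (take t w) LY)"
      unfolding P_def LX by (cases x) (auto simp: nat_le_iff_add)
    also have "\<dots> \<longleftrightarrow> x \<in> {c} \<times> {r..<r + count_list w LY}"
      unfolding ex_count_list_take by (cases x) auto
    finally have "(\<exists>t. P c r (a # w) x 0 (Suc t)) \<longleftrightarrow> x \<in> {c} \<times> {r..<r + count_list w LY}" .
    moreover have "P c r (a # w) x (Suc s) (Suc t) \<longleftrightarrow> P (Suc c) r w x s t" for s t
      by (simp add: P_def LX)
    ultimately show ?thesis by (subst ex_less_Suc_split) (simp add: IH LX)
  next
    case LY
    have "\<not> P c r (a # w) x 0 (Suc t)" for t
      by (simp add: P_def LY)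
    moreover have "P c r (a # w) x (Suc s) (Suc t) \<longleftrightarrow> P c (Suc r) w x s t" for s t
      by (simp add: P_def LY)
    ultimately show ?thesis by (subst ex_less_Suc_split) (simp add: IH LY)
  qed
  then show ?case unfolding P_def by blast
qed

lemma board_eq_board_from: "board w = board_from 0 0 w"
  by (simp add: board_def board_from_eq)

lemma board_from_subset:
  "board_from c r w \<subseteq> {c..<c + count_list w LX} \<times> {r..<r + count_list w LY}"
  by (induction w arbitrary: c r) (fastforce split: letter.splits)+

lemma finite_board_from: "finite (board_from c r w)"
  by (rule finite_subset[OF board_from_subset]) simp


section \<open>Placements\<close>

text \<open>The numbers of rooks and files are left free: adding a column changes them, so the
  induction sums over all of them at once.\<close>

definition placements :: "cell set \<Rightarrow> (cell set \<times> cell set) set" where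
  "placements B = {(R, F). R \<subseteq> B \<and> F \<subseteq> B \<and> nonattacking R F}"

lemma finite_placements: "finite B \<Longrightarrow> finite (placements B)"
  by (rule finite_subset[of _ "Pow B \<times> Pow B"]) (auto simp: placements_def)

text \<open>A rook and a file in one cell would share a column, so \<open>nonattacking\<close>
  yields the disjointness.\<close>

lemma mixed_placements_eq:
  "mixed_placements k l B = {\<phi> \<in> placements B. card (fst \<phi>) = k \<and> card (snd \<phi>) = l}"
  by (fastforce simp: mixed_placements_def placements_def nonattacking_def)

text \<open>Rooks lie in distinct rows, so \<open>snd\<close> is injective on them. Files may share
  rows and are not counted.\<close>

lemma placements_card_rows:
  assumes "(R, F) \<in> placements B" "B \<subseteq> C \<times> D" "finite D"
  shows "card R \<le> card D"
proof -
  have "inj_on snd R" "snd ` R \<subseteq> D"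
    using assms by (auto simp: placements_def nonattacking_def inj_on_def)
  then show ?thesis using assms(3) by (metis card_inj_on_le)
qed

text \<open>All pieces, rooks and files alike, lie in distinct columns.\<close>

lemma placements_card_columns:
  assumes "(R, F) \<in> placements B" "B \<subseteq> C \<times> D" "finite C" "finite B"
  shows "card R + card F \<le> card C"
proof -
  have *: "inj_on fst (R \<union> F)" "fst ` (R \<union> F) \<subseteq> C" "R \<inter> F = {}" "finite R" "finite F"
  proof -
    have sub: "R \<subseteq> B" "F \<subseteq> B" and na: "nonattacking R F"
      using assms(1) by (auto simp: placements_def)
    then show "finite R" "finite F" "fst ` (R \<union> F) \<subseteq> C"
      using assms(2,4) by (auto intro: finite_subset)
    show "inj_on fst (R \<union> F)"
      using na unfolding nonattacking_def by (intro inj_onI) (metis Un_iff)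
    show "R \<inter> F = {}"
      using na unfolding nonattacking_def by blast
  qed
  then show ?thesis using card_inj_on_le[OF *(1,2) assms(3)] by (simp add: card_Un_disjoint)
qed

text \<open>Placements are grouped by their restriction to \<open>B\<close>. Column \<open>c\<close>
  holds at most one further piece. Its row must be free of rooks of \<open>R\<close>: for a rook
  since rooks have distinct rows, for a file since every rook of \<open>R\<close> lies to its
  right.\<close>

lemma sum_placements_add_column:
  fixes f :: "cell set \<times> cell set \<Rightarrow> 'a::comm_monoid_add"
  assumes B: "B \<subseteq> {c<..} \<times> D" and fin: "finite B" "finite D"
  shows "sum f (placements ({c} \<times> D \<union> B)) =
    (\<Sum>(R, F)\<in>placements B.
       f (R, F) + (\<Sum>i\<in>D - snd ` R. f (insert (c, i) R, F) + f (R, insert (c, i) F)))"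
proof -
  let ?B = "{c} \<times> D \<union> B"
  let ?\<rho> = "\<lambda>(R, F). (R \<inter> B, F \<inter> B)"
  have fin': "finite ?B" using fin by simp
  have "sum f (placements ?B) = (\<Sum>\<phi>\<in>placements B. sum f {\<psi> \<in> placements ?B. ?\<rho> \<psi> = \<phi>})"
    by (rule sum.group[symmetric])
       (use finite_placements[OF fin(1)] finite_placements[OF fin'] in
         \<open>auto simp: placements_def nonattacking_def\<close>)
  also have "\<dots> = (\<Sum>(R, F)\<in>placements B.
       f (R, F) + (\<Sum>i\<in>D - snd ` R. f (insert (c, i) R, F) + f (R, insert (c, i) F)))"
  proof (intro sum.cong refl, clarify)
    fix R F assume RF: "(R, F) \<in> placements B"
    let ?D = "D - snd ` R"
    let ?r = "\<lambda>i. (insert (c, i) R, F)" and ?f = "\<lambda>i. (R, insert (c, i) F)"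
    have sub: "R \<subseteq> B" "F \<subseteq> B" and na: "nonattacking R F"
      using RF by (auto simp: placements_def)
    have notin: "(c, i) \<notin> B" for i using B by auto
    have gt: "c < fst d" "snd d \<in> D" if "d \<in> B" for d using B that by auto
    have "{\<psi> \<in> placements ?B. ?\<rho> \<psi> = (R, F)} = insert (R, F) (?r ` ?D \<union> ?f ` ?D)"
    proof (intro equalityI subsetI)
      fix \<psi> assume "\<psi> \<in> {\<psi> \<in> placements ?B. ?\<rho> \<psi> = (R, F)}"
      then obtain R' F' where \<psi>: "\<psi> = (R', F')" and sub': "R' \<subseteq> ?B" "F' \<subseteq> ?B"
        and na': "nonattacking R' F'" and RF': "R = R' \<inter> B" "F = F' \<inter> B"
        by (auto simp: placements_def)
      \<comment> \<open>Outside column \<open>c\<close> the enlarged board is just \<open>B\<close>,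
        so the placement differs from its restriction only in column \<open>c\<close>.\<close>
      have *: "R' = R \<union> {d \<in> R'. fst d = c}" "F' = F \<union> {d \<in> F'. fst d = c}"
        using sub' unfolding RF' by (auto dest: gt(1))
      have RR: "d = e" if "d \<in> R'" "e \<in> R'" "fst d = fst e \<or> snd d = snd e" for d e
        using na' that unfolding nonattacking_def by blast
      have FF: "d = e" if "d \<in> F'" "e \<in> F'" "fst d = fst e" for d e
        using na' that unfolding nonattacking_def by blast
      have FR: "fst d \<noteq> fst e" "snd d = snd e \<Longrightarrow> \<not> fst d < fst e" if "d \<in> F'" "e \<in> R'" for d e
        using na' that unfolding nonattacking_def by blast+
      consider "\<forall>d\<in>R' \<union> F'. fst d \<noteq> c"
        | i where "(c, i) \<in> R'" | i where "(c, i) \<in> F'"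
        by (metis Un_iff prod.collapse)
      then show "\<psi> \<in> insert (R, F) (?r ` ?D \<union> ?f ` ?D)"
      proof cases
        case 1
        then have "R' = R" "F' = F" using * by auto
        then show ?thesis using \<psi> by simp
      next
        case (2 i)
        have "d = (c, i)" if "d \<in> R'" "fst d = c" for d using RR[OF that(1) 2] that(2) by simp
        then have "{d \<in> R'. fst d = c} = {(c, i)}" using 2 fst_conv[of c i] by blast
        moreover have "{d \<in> F'. fst d = c} = {}" using FR(1)[OF _ 2] by fastforce
        ultimately have "R' = insert (c, i) R" "F' = F"
          using * by (metis Un_insert_right sup_bot_right)+
        moreover have "i \<in> D" using sub' 2 notin by auto
        moreover have "i \<noteq> snd d" if "d \<in> R" for d
        proof
          assume "i = snd d"
          then have "d = (c, i)" using RR[OF _ 2, of d] that RF' by simp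
          then show False using gt(1)[of d] that sub by auto
        qed
        ultimately have "i \<in> ?D" "\<psi> = ?r i" using \<psi> by auto
        then show ?thesis by blast
      next
        case (3 i)
        have "d = (c, i)" if "d \<in> F'" "fst d = c" for d using FF[OF that(1) 3] that(2) by simp
        then have "{d \<in> F'. fst d = c} = {(c, i)}" using 3 fst_conv[of c i] by blast
        moreover have "{d \<in> R'. fst d = c} = {}" using FR(1)[OF 3] by fastforce
        ultimately have "F' = insert (c, i) F" "R' = R"
          using * by (metis Un_insert_right sup_bot_right)+
        moreover have "i \<in> D" using sub' 3 notin by auto
        \<comment> \<open>A rook of \<open>R\<close> in row \<open>i\<close> would have the new file
          in its row and to its left.\<close>
        moreover have "i \<noteq> snd d" if "d \<in> R" for d
          using FR(2)[OF 3, of d] gt(1)[of d] that unfolding RF' by auto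
        ultimately have "i \<in> ?D" "\<psi> = ?f i" using \<psi> by auto
        then show ?thesis by blast
      qed
    next
      \<comment> \<open>Conversely, the new cell is left of all pieces, so only its row can
        conflict. A file of \<open>F\<close> in row \<open>i\<close> is harmless, as it lies to the
        right of the new piece.\<close>
      have ne: "fst d \<noteq> c" "c \<noteq> fst d" "\<not> fst d < c" if "d \<in> R \<or> d \<in> F" for d
        using gt(1)[of d] sub that by auto
      have r: "nonattacking (insert (c, i) R) F" "nonattacking R (insert (c, i) F)"
        if "i \<in> ?D" for i
      proof -
        have row: "snd d \<noteq> i" "i \<noteq> snd d" if "d \<in> R" for d using that \<open>i \<in> ?D\<close> by auto
        show "nonattacking (insert (c, i) R) F" "nonattacking R (insert (c, i) F)"
          using na unfolding nonattacking_def by (simp_all add: ne row)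
      qed
      have "R \<inter> B = R" "F \<inter> B = F" using sub by auto
      fix \<psi> assume "\<psi> \<in> insert (R, F) (?r ` ?D \<union> ?f ` ?D)"
      then show "\<psi> \<in> {\<psi> \<in> placements ?B. ?\<rho> \<psi> = (R, F)}"
        using r na sub notin by (auto simp: placements_def)
    qed
    moreover have notin': "(c, i) \<notin> R" "(c, i) \<notin> F" for i using notin sub by auto
    moreover have "inj_on ?r ?D" "inj_on ?f ?D"
      using notin' by (intro inj_onI; metis Pair_inject insert_iff)+
    moreover have "?r ` ?D \<inter> ?f ` ?D = {}" "(R, F) \<notin> ?r ` ?D \<union> ?f ` ?D"
      using notin' by blast+
    ultimately show "sum f {\<psi> \<in> placements ?B. ?\<rho> \<psi> = (R, F)} =
        f (R, F) + (\<Sum>i\<in>?D. f (insert (c, i) R, F) + f (R, insert (c, i) F))"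
      using fin by (simp add: sum.union_disjoint sum.reindex sum.distrib)
  qed
  finally show ?thesis .
qed

section \<open>Empty boxes after adding a leftmost column\<close>

lemma mem_empty_boxes:
  "(a, b) \<in> empty_boxes B (R, F) \<longleftrightarrow> (a, b) \<in> B \<and> (a, b) \<notin> R \<and> (a, b) \<notin> F \<and>
     (\<forall>j<b. (a, j) \<notin> R \<and> (a, j) \<notin> F) \<and> (\<forall>a'>a. (a', b) \<notin> R)"
  by (auto simp: empty_boxes_def cancelled_def)

text \<open>Cancellation acts upwards and to the left, so a piece in the leftmost column cancels
  nothing in \<open>B\<close>. In column \<open>c\<close> the rooks of \<open>R\<close> cancel their
  rows, and a new piece in row \<open>i\<close> leaves empty only the uncancelled cells below
  it.\<close>

lemma card_empty_boxes_add_column: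
  assumes B: "B \<subseteq> {c<..} \<times> D" and fin: "finite B" "finite D"
    and RF: "(R, F) \<in> placements B"
  shows "card (empty_boxes ({c} \<times> D \<union> B) (R, F)) =
      card (empty_boxes B (R, F)) + card (D - snd ` R)"
    and "i \<in> D - snd ` R \<Longrightarrow> card (empty_boxes ({c} \<times> D \<union> B) (insert (c, i) R, F)) =
      card (empty_boxes B (R, F)) + card {j \<in> D - snd ` R. j < i}"
    and "i \<in> D - snd ` R \<Longrightarrow> card (empty_boxes ({c} \<times> D \<union> B) (R, insert (c, i) F)) =
      card (empty_boxes B (R, F)) + card {j \<in> D - snd ` R. j < i}"
proof -
  let ?B = "{c} \<times> D \<union> B"
  have "R \<subseteq> B" "F \<subseteq> B" using RF by (auto simp: placements_def)
  then have notin: "(c, b) \<notin> B" "(c, b) \<notin> R" "(c, b) \<notin> F" for b using B by auto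
  have gt: "c < a" if "(a, b) \<in> B" for a b using B that by auto
  have gtR: "c < a" if "(a, b) \<in> R" for a b using gt \<open>R \<subseteq> B\<close> that by auto
  have rows: "b \<in> snd ` R \<longleftrightarrow> (\<exists>a>c. (a, b) \<in> R)" for b
    using gtR by force
  \<comment> \<open>Each of the three claims is reduced to identifying the part \<open>S\<close> of
    the empty boxes in column \<open>c\<close> and checking that nothing changes elsewhere.\<close>
  have card: "card E = card (empty_boxes B (R, F)) + card S"
    if "finite S" and
      "\<And>b. (c, b) \<in> E \<longleftrightarrow> b \<in> S" and
      "\<And>a b. a \<noteq> c \<Longrightarrow> (a, b) \<in> E \<longleftrightarrow> (a, b) \<in> empty_boxes B (R, F)" for S E
  proof -
    have c: "(c, b) \<notin> empty_boxes B (R, F)" for b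
      using notin by (simp add: mem_empty_boxes)
    have "E = empty_boxes B (R, F) \<union> {c} \<times> S"
    proof (rule Set.set_eqI)
      show "x \<in> E \<longleftrightarrow> x \<in> empty_boxes B (R, F) \<union> {c} \<times> S" for x
        using that(2,3) c by (cases x; cases "fst x = c") auto
    qed
    moreover have "finite (empty_boxes B (R, F))"
      using fin by (simp add: empty_boxes_def)
    moreover have "empty_boxes B (R, F) \<inter> {c} \<times> S = {}" using c by auto
    ultimately show ?thesis
      using that(1) by (simp add: card_Un_disjoint card_cartesian_product_singleton)
  qed
  show "card (empty_boxes ?B (R, F)) = card (empty_boxes B (R, F)) + card (D - snd ` R)"
    by (rule card) (use fin notin rows in \<open>auto simp: mem_empty_boxes\<close>)
  assume i: "i \<in> D - snd ` R"
  \<comment> \<open>Puts \<open>b < i\<close> into the shape of \<open>mem_empty_boxes\<close>: the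
    new piece is neither in the cell nor below it.\<close>
  have lt: "b < i \<longleftrightarrow> b \<noteq> i \<and> (\<forall>j<b. j \<noteq> i)" for b
    by (metis less_asym nat_neq_iff)
  show "card (empty_boxes ?B (insert (c, i) R, F)) =
      card (empty_boxes B (R, F)) + card {j \<in> D - snd ` R. j < i}"
  proof (rule card)
    show "(c, b) \<in> empty_boxes ?B (insert (c, i) R, F) \<longleftrightarrow> b \<in> {j \<in> D - snd ` R. j < i}" for b
      unfolding mem_empty_boxes mem_Collect_eq Diff_iff rows
      by (auto simp: notin lt)
    show "(a, b) \<in> empty_boxes ?B (insert (c, i) R, F) \<longleftrightarrow> (a, b) \<in> empty_boxes B (R, F)"
      if "a \<noteq> c" for a b
      using that unfolding mem_empty_boxes by (auto dest: gt)
  qed (use fin in simp)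
  show "card (empty_boxes ?B (R, insert (c, i) F)) =
      card (empty_boxes B (R, F)) + card {j \<in> D - snd ` R. j < i}"
  proof (rule card)
    show "(c, b) \<in> empty_boxes ?B (R, insert (c, i) F) \<longleftrightarrow> b \<in> {j \<in> D - snd ` R. j < i}" for b
      unfolding mem_empty_boxes mem_Collect_eq Diff_iff rows
      by (auto simp: notin lt)
    show "(a, b) \<in> empty_boxes ?B (R, insert (c, i) F) \<longleftrightarrow> (a, b) \<in> empty_boxes B (R, F)"
      if "a \<noteq> c" for a b
      using that unfolding mem_empty_boxes by (auto dest: gt)
  qed (use fin in simp)
qed

text \<open>The rank \<open>card {j \<in> A. j < i}\<close> maps \<open>A\<close> bijectively onto
  \<open>{..<card A}\<close>. In the induction, a new maximum has rank \<open>card A\<close> and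
  leaves the other ranks unchanged.\<close>

lemma sum_rank:
  fixes A :: "'a::linorder set" and f :: "nat \<Rightarrow> 'b::comm_monoid_add"
  assumes "finite A"
  shows "(\<Sum>i\<in>A. f (card {j \<in> A. j < i})) = sum f {..<card A}"
  using assms
proof (induction rule: finite_linorder_max_induct)
  case empty
  then show ?case by simp
next
  case (insert b A)
  have "{j \<in> insert b A. j < b} = A" using insert by auto
  moreover have "{j \<in> insert b A. j < i} = {j \<in> A. j < i}" if "i \<in> A" for i
    using insert that by auto
  moreover have "b \<notin> A" using insert by auto
  ultimately show ?case using insert by (simp add: add.commute)
qed


section \<open>The projection of the free algebra onto the Ore algebra\<close>

lemma free_scalar_add: "free_scalar (a + b) = free_scalar a + free_scalar b"
  by (simp add: free_scalar_def single_add)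

lemma free_scalar_mult: "free_scalar (a * b) = free_scalar a * free_scalar b"
  by (simp add: free_scalar_def mult_single flip: zero_list_def)

lemma free_scalar_1: "free_scalar 1 = 1"
  by (simp add: free_scalar_def flip: zero_list_def single_one)

lemma free_scalar_sum: "free_scalar (sum f S) = (\<Sum>i\<in>S. free_scalar (f i))"
  by (induction S rule: infinite_finite_induct)
     (simp_all add: free_scalar_add, simp_all add: free_scalar_def)

text \<open>By additivity it suffices to treat monomials, where the empty word is neutral for
  concatenation and complex coefficients commute.\<close>

lemma free_scalar_commute: "p * free_scalar c = free_scalar c * p"
proof (induction p rule: update_induct)
  case const
  then show ?case by simp
next
  case (update f a b)
  \<comment> \<open>\<open>a\<close> is not yet a key of \<open>f\<close>, so the update is an
    addition.\<close>
  have "Poly_Mapping.update a b f = f + Poly_Mapping.single a b"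
    using update.hyps
    by (intro poly_mapping_eqI) (auto simp: lookup_update lookup_add lookup_single when_def in_keys_iff)
  moreover have "Poly_Mapping.single a b * free_scalar c = free_scalar c * Poly_Mapping.single a b"
    by (simp add: free_scalar_def mult_single mult.commute flip: zero_list_def)
  ultimately show ?case using update.IH by (simp add: distrib_left distrib_right)
qed

context
  fixes mu nu q :: complex
begin

interpretation I: ideal "ore_ideal mu nu q" ring_of_type_algebra
  by (rule ideal_ore_ideal)

interpretation A: ring "ore_algebra mu nu q"
  by (rule ring_ore_algebra)

lemma carrier_free: "p \<in> carrier (ring_of_type_algebra :: free_alg ring)"
  by (simp add: ring_of_type_algebra_def)

lemma ore_class_hom: "ore_class mu nu q \<in> ring_hom ring_of_type_algebra (ore_algebra mu nu q)"
  using I.rcos_ring_hom by (simp add: ore_class_def[abs_def] ore_algebra_def)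

lemma ore_class_closed: "ore_class mu nu q p \<in> carrier (ore_algebra mu nu q)"
  using ring_hom_closed[OF ore_class_hom carrier_free] .

lemma ore_class_mult:
  "ore_class mu nu q (p * p') = ore_class mu nu q p \<otimes>\<^bsub>ore_algebra mu nu q\<^esub> ore_class mu nu q p'"
  using ring_hom_mult[OF ore_class_hom carrier_free carrier_free, of p p']
  by (simp add: ring_of_type_algebra_def)

lemma ore_class_add:
  "ore_class mu nu q (p + p') = ore_class mu nu q p \<oplus>\<^bsub>ore_algebra mu nu q\<^esub> ore_class mu nu q p'"
  using ring_hom_add[OF ore_class_hom carrier_free carrier_free, of p p']
  by (simp add: ring_of_type_algebra_def)

lemma ore_class_1: "ore_class mu nu q 1 = \<one>\<^bsub>ore_algebra mu nu q\<^esub>"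
  using ring_hom_one[OF ore_class_hom] by (simp add: ring_of_type_algebra_def)

lemma ore_class_0: "ore_class mu nu q 0 = \<zero>\<^bsub>ore_algebra mu nu q\<^esub>"
  using ring_hom_zero[OF ore_class_hom ring_ring_of_type_algebra ring_ore_algebra]
  by (simp add: ring_of_type_algebra_def)

lemma ore_class_power:
  "ore_class mu nu q (p ^ n) = ore_class mu nu q p [^]\<^bsub>ore_algebra mu nu q\<^esub> n"
  by (induction n) (simp_all add: ore_class_1 ore_class_mult power_Suc2 del: power_Suc)

lemma ore_class_sum:
  "finite S \<Longrightarrow> ore_class mu nu q (sum f S) =
     (\<Oplus>\<^bsub>ore_algebra mu nu q\<^esub>i\<in>S. ore_class mu nu q (f i))"
  by (induction S rule: finite_induct)
     (simp_all add: ore_class_0 ore_class_add A.finsum_insert ore_class_closed)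

lemma ore_word_eq:
  "ore_word mu nu q w = ore_class mu nu q (foldr (\<lambda>a p. free_gen a * p) w 1)"
  by (induction w) (simp_all add: ore_word_def ore_class_1 ore_class_mult ore_gen_def)

text \<open>Equality of classes serves as a congruence on the free algebra, so that computations
  can be carried out in a type of class \<open>ring_1\<close>.\<close>

abbreviation ore_cong :: "free_alg \<Rightarrow> free_alg \<Rightarrow> bool" (infix "\<approx>" 50) where
  "p \<approx> p' \<equiv> ore_class mu nu q p = ore_class mu nu q p'"

lemma ore_cong_add: "p \<approx> p' \<Longrightarrow> r \<approx> r' \<Longrightarrow> p + r \<approx> p' + r'"
  by (simp add: ore_class_add)

lemma ore_cong_mult: "p \<approx> p' \<Longrightarrow> r \<approx> r' \<Longrightarrow> p * r \<approx> p' * r'"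
  by (simp add: ore_class_mult)

lemma ore_cong_sum: "(\<And>i. i \<in> S \<Longrightarrow> f i \<approx> g i) \<Longrightarrow> sum f S \<approx> sum g S"
  by (induction S rule: infinite_finite_induct) (simp_all add: ore_class_add)

abbreviation (input) gX :: free_alg where "gX \<equiv> free_gen LX"
abbreviation (input) gY :: free_alg where "gY \<equiv> free_gen LY"

lemma ore_cong_XY: "gX * gY \<approx> free_scalar q * gY * gX + free_scalar mu + free_scalar nu * gY"
  using ore_relation[of mu nu q]
  by (simp add: ore_gen_def ore_scalar_def ore_class_add ore_class_mult)

text \<open>Multiply by \<open>gY\<close> on the right: only the term ending in \<open>gX\<close>
  uses the relation, and it contributes the summand \<open>j = n\<close>. For \<open>n = 0\<close>
  the truncated exponent \<open>n - 1\<close> occurs only in an empty sum.\<close>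

lemma ore_cong_X_Ypower:
  "gX * gY ^ n \<approx> free_scalar (q ^ n) * gY ^ n * gX +
     (\<Sum>j<n. free_scalar (mu * q ^ j) * gY ^ (n - 1) + free_scalar (nu * q ^ j) * gY ^ n)"
proof (induction n)
  case 0
  then show ?case by (simp add: free_scalar_1)
next
  case (Suc n)
  let ?S = "\<lambda>n. \<Sum>j<n. free_scalar (mu * q ^ j) * gY ^ (n - 1) + free_scalar (nu * q ^ j) * gY ^ n"
  have "gX * gY ^ Suc n = gX * gY ^ n * gY"
    by (simp add: power_Suc2 mult.assoc del: power_Suc)
  also have "\<dots> \<approx> (free_scalar (q ^ n) * gY ^ n * gX + ?S n) * gY"
    by (intro ore_cong_mult Suc.IH refl)
  also have "(free_scalar (q ^ n) * gY ^ n * gX + ?S n) * gY =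
      free_scalar (q ^ n) * gY ^ n * (gX * gY) + ?S n * gY"
    by (simp add: algebra_simps)
  also have "\<dots> \<approx> free_scalar (q ^ n) * gY ^ n *
      (free_scalar q * gY * gX + free_scalar mu + free_scalar nu * gY) + ?S n * gY"
    by (intro ore_cong_add ore_cong_mult ore_cong_XY refl)
  also have "free_scalar (q ^ n) * gY ^ n *
      (free_scalar q * gY * gX + free_scalar mu + free_scalar nu * gY) =
      free_scalar (q ^ Suc n) * gY ^ Suc n * gX +
      (free_scalar (mu * q ^ n) * gY ^ n + free_scalar (nu * q ^ n) * gY ^ Suc n)"
  proof -
    \<comment> \<open>The algebra is not commutative; these rules only move scalars to the front and
      merge them.\<close>
    have c: "gY ^ n * (free_scalar d * z) = free_scalar d * (gY ^ n * z)" for d z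
      by (metis free_scalar_commute mult.assoc)
    have c': "gY ^ n * free_scalar d = free_scalar d * gY ^ n" for d
      by (rule free_scalar_commute)
    have s: "free_scalar a * (free_scalar b * z) = free_scalar (a * b) * z" for a b z
      by (simp add: free_scalar_mult mult.assoc)
    show ?thesis
      by (simp add: distrib_left mult.assoc c c' s power_Suc2
          mult.commute[of "q ^ n" mu] mult.commute[of "q ^ n" nu] del: power_Suc)
  qed
  also have "?S n * gY =
      (\<Sum>j<n. free_scalar (mu * q ^ j) * gY ^ n + free_scalar (nu * q ^ j) * gY ^ Suc n)"
    unfolding sum_distrib_right
  proof (rule sum.cong[OF refl])
    fix j assume "j \<in> {..<n}"
    \<comment> \<open>The index \<open>j < n\<close> forces \<open>n > 0\<close>, so
      \<open>n - 1\<close> is not truncated.\<close>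
    then have "gY ^ (n - 1) * gY = gY ^ n" by (cases n) (simp_all add: power_Suc2 del: power_Suc)
    then show "(free_scalar (mu * q ^ j) * gY ^ (n - 1) + free_scalar (nu * q ^ j) * gY ^ n) * gY =
        free_scalar (mu * q ^ j) * gY ^ n + free_scalar (nu * q ^ j) * gY ^ Suc n"
      by (simp add: distrib_right mult.assoc power_Suc2 del: power_Suc)
  qed
  finally show ?case by (simp add: algebra_simps)
qed


section \<open>Normal ordering\<close>

text \<open>The summand of \<open>mixed_number\<close> with its prefactor moved inside, the
  exponents of \<open>mu\<close> and \<open>nu\<close> being read off the placement.\<close>

definition weight :: "cell set \<Rightarrow> cell set \<times> cell set \<Rightarrow> complex" where
  "weight B \<phi> = mu ^ card (fst \<phi>) * nu ^ card (snd \<phi>) * q ^ card (empty_boxes B \<phi>)"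

text \<open>A term of the expansion of a word with \<open>N\<close> letters \<open>LY\<close> and
  \<open>M\<close> letters \<open>LX\<close>, kept as parameters so that prepending a letter
  increments one of them.\<close>

definition ordered :: "nat \<Rightarrow> nat \<Rightarrow> complex \<Rightarrow> nat \<Rightarrow> nat \<Rightarrow> free_alg" where
  "ordered N M d k l = free_scalar d * (gY ^ (N - k) * gX ^ (M - k - l))"

lemma Y_ordered: "k \<le> N \<Longrightarrow> gY * ordered N M d k l = ordered (Suc N) M d k l"
  unfolding ordered_def mult.assoc[symmetric] free_scalar_commute
  by (simp add: Suc_diff_le mult.assoc)

lemma X_ordered:
  assumes "k + l \<le> M"
  shows "gX * ordered N M d k l \<approx>
    ordered N (Suc M) (d * q ^ (N - k)) k l +
    (\<Sum>j<N - k. ordered N (Suc M) (d * mu * q ^ j) (Suc k) l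
       + ordered N (Suc M) (d * nu * q ^ j) k (Suc l))"
proof -
  let ?n = "N - k" and ?Z = "gX ^ (M - k - l)"
  have s: "free_scalar a * (free_scalar b * z) = free_scalar (a * b) * z" for a b z
    by (simp add: free_scalar_mult mult.assoc)
  have "gX * ordered N M d k l = free_scalar d * (gX * gY ^ ?n) * ?Z"
    unfolding ordered_def mult.assoc[symmetric] free_scalar_commute ..
  also have "\<dots> \<approx> free_scalar d * (free_scalar (q ^ ?n) * gY ^ ?n * gX +
     (\<Sum>j<?n. free_scalar (mu * q ^ j) * gY ^ (?n - 1) + free_scalar (nu * q ^ j) * gY ^ ?n)) * ?Z"
    by (intro ore_cong_mult ore_cong_X_Ypower refl)
  also have "free_scalar d * (free_scalar (q ^ ?n) * gY ^ ?n * gX +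
     (\<Sum>j<?n. free_scalar (mu * q ^ j) * gY ^ (?n - 1) + free_scalar (nu * q ^ j) * gY ^ ?n)) * ?Z =
    free_scalar (d * q ^ ?n) * (gY ^ ?n * (gX * ?Z)) +
    (\<Sum>j<?n. free_scalar (d * mu * q ^ j) * (gY ^ (?n - 1) * ?Z)
      + free_scalar (d * nu * q ^ j) * (gY ^ ?n * ?Z))"
    by (simp add: distrib_left distrib_right sum_distrib_left sum_distrib_right mult.assoc s)
  also have "gX * ?Z = gX ^ (Suc M - k - l)"
    using assms by (simp add: Suc_diff_le flip: power_Suc)
  \<comment> \<open>The other exponents agree as well: \<open>N - Suc k\<close> is
    \<open>?n - 1\<close>, and both \<open>Suc M - Suc k - l\<close> and
    \<open>Suc M - k - Suc l\<close> are \<open>M - k - l\<close>.\<close>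
  finally show ?thesis
    by (simp add: ordered_def)
qed

text \<open>The offsets are arbitrary because the board of the tail starts at \<open>Suc c\<close>
  after an \<open>LX\<close> and at \<open>Suc r\<close> after an \<open>LY\<close>.\<close>

lemma word_cong_sum_placements:
  "foldr (\<lambda>a p. free_gen a * p) w 1 \<approx>
    (\<Sum>\<phi>\<in>placements (board_from c r w).
      ordered (count_list w LY) (count_list w LX) (weight (board_from c r w) \<phi>)
        (card (fst \<phi>)) (card (snd \<phi>)))"
proof (induction w arbitrary: c r)
  case Nil
  have "placements {} = {({}, {})}" by (auto simp: placements_def nonattacking_def)
  then show ?case by (simp add: ordered_def weight_def empty_boxes_def free_scalar_1)
next
  case (Cons a w)
  let ?N = "count_list w LY" and ?M = "count_list w LX"
  let ?m = "foldr (\<lambda>a p. free_gen a * p) w 1"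
  show ?case
  proof (cases a)
    case LY
    let ?B = "board_from c (Suc r) w"
    have "gY * ?m \<approx> gY * (\<Sum>\<phi>\<in>placements ?B.
        ordered ?N ?M (weight ?B \<phi>) (card (fst \<phi>)) (card (snd \<phi>)))"
      by (intro ore_cong_mult Cons.IH refl)
    \<comment> \<open>The cells, hence placements and weights, stay the same; only the exponent of
      \<open>gY\<close> grows. The row bound on rooks keeps \<open>N - k\<close> from
      truncating.\<close>
    also have "gY * (\<Sum>\<phi>\<in>placements ?B.
        ordered ?N ?M (weight ?B \<phi>) (card (fst \<phi>)) (card (snd \<phi>))) =
      (\<Sum>\<phi>\<in>placements ?B. ordered (Suc ?N) ?M (weight ?B \<phi>) (card (fst \<phi>)) (card (snd \<phi>)))"
      unfolding sum_distrib_left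
      by (intro sum.cong refl Y_ordered)
         (use placements_card_rows[OF _ board_from_subset] in fastforce)
    finally show ?thesis by (simp add: LY)
  next
    case LX
    let ?B = "board_from (Suc c) r w" and ?D = "{r..<r + ?N}"
    let ?B' = "{c} \<times> ?D \<union> ?B"
    let ?t = "\<lambda>\<phi>. ordered ?N (Suc ?M) (weight ?B' \<phi>) (card (fst \<phi>)) (card (snd \<phi>))"
    have B: "?B \<subseteq> {c<..} \<times> ?D" using board_from_subset[of "Suc c" r w] by fastforce
    have fin: "finite ?B" by (rule finite_board_from)
    have "gX * ?m \<approx> gX * (\<Sum>\<phi>\<in>placements ?B.
        ordered ?N ?M (weight ?B \<phi>) (card (fst \<phi>)) (card (snd \<phi>)))"
      by (intro ore_cong_mult Cons.IH refl)
    also have "gX * (\<Sum>\<phi>\<in>placements ?B.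
        ordered ?N ?M (weight ?B \<phi>) (card (fst \<phi>)) (card (snd \<phi>))) \<approx> (\<Sum>(R, F)\<in>placements ?B.
       ?t (R, F) + (\<Sum>i\<in>?D - snd ` R. ?t (insert (c, i) R, F) + ?t (R, insert (c, i) F)))"
      unfolding sum_distrib_left
    proof (rule ore_cong_sum, clarify)
      fix R F assume RF: "(R, F) \<in> placements ?B"
      let ?A = "?D - snd ` R"
      let ?e = "card (empty_boxes ?B (R, F))"
      have sub: "R \<subseteq> ?B" "F \<subseteq> ?B" and na: "nonattacking R F"
        using RF by (auto simp: placements_def)
      have finRF: "finite R" "finite F" using sub fin by (auto intro: finite_subset)
      have notin: "(c, i) \<notin> R" "(c, i) \<notin> F" for i using sub B by auto
      have "inj_on snd R" using na by (auto simp: nonattacking_def inj_on_def)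
      moreover have "snd ` R \<subseteq> ?D" using sub B by fastforce
      \<comment> \<open>The rooks occupy \<open>card R\<close> distinct rows of \<open>?D\<close>,
        and the remaining rows index the uncancelled cells of the new column.\<close>
      ultimately have cardA: "card ?A = ?N - card R"
        using finRF by (simp add: card_Diff_subset card_image)
      have le: "card R + card F \<le> ?M"
        using placements_card_columns[OF RF board_from_subset _ fin] by simp
      note card = card_empty_boxes_add_column[OF B fin _ RF]
      have "gX * ordered ?N ?M (weight ?B (R, F)) (card R) (card F) \<approx>
        ordered ?N (Suc ?M) (weight ?B (R, F) * q ^ (?N - card R)) (card R) (card F) +
        (\<Sum>j<?N - card R.
          ordered ?N (Suc ?M) (weight ?B (R, F) * mu * q ^ j) (Suc (card R)) (card F) +
          ordered ?N (Suc ?M) (weight ?B (R, F) * nu * q ^ j) (card R) (Suc (card F)))"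
        by (rule X_ordered[OF le])
      also have "weight ?B (R, F) * q ^ (?N - card R) = weight ?B' (R, F)"
        using card(1) cardA by (simp add: weight_def power_add)
      \<comment> \<open>The exponent \<open>j\<close> becomes the number of uncancelled cells below
        row \<open>i\<close>, which is the rank of \<open>i\<close> in \<open>?A\<close>.\<close>
      also have "(\<Sum>j<?N - card R.
          ordered ?N (Suc ?M) (weight ?B (R, F) * mu * q ^ j) (Suc (card R)) (card F) +
          ordered ?N (Suc ?M) (weight ?B (R, F) * nu * q ^ j) (card R) (Suc (card F))) =
        (\<Sum>i\<in>?A.
          ordered ?N (Suc ?M) (weight ?B (R, F) * mu * q ^ card {j \<in> ?A. j < i})
            (Suc (card R)) (card F) +
          ordered ?N (Suc ?M) (weight ?B (R, F) * nu * q ^ card {j \<in> ?A. j < i})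
            (card R) (Suc (card F)))"
        unfolding cardA[symmetric] by (rule sum_rank[symmetric]) simp
      also have "\<dots> = (\<Sum>i\<in>?A. ?t (insert (c, i) R, F) + ?t (R, insert (c, i) F))"
      proof (rule sum.cong[OF refl])
        fix i assume i: "i \<in> ?A"
        have "weight ?B' (insert (c, i) R, F) = weight ?B (R, F) * mu * q ^ card {j \<in> ?A. j < i}"
          "weight ?B' (R, insert (c, i) F) = weight ?B (R, F) * nu * q ^ card {j \<in> ?A. j < i}"
          using card(2,3)[OF _ i] notin finRF by (simp_all add: weight_def power_add)
        then show "ordered ?N (Suc ?M) (weight ?B (R, F) * mu * q ^ card {j \<in> ?A. j < i})
            (Suc (card R)) (card F) +
          ordered ?N (Suc ?M) (weight ?B (R, F) * nu * q ^ card {j \<in> ?A. j < i})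
            (card R) (Suc (card F)) = ?t (insert (c, i) R, F) + ?t (R, insert (c, i) F)"
          using notin finRF by simp
      qed
      finally show "gX * ordered ?N ?M (weight ?B (R, F)) (card (fst (R, F))) (card (snd (R, F))) \<approx>
          ?t (R, F) + (\<Sum>i\<in>?A. ?t (insert (c, i) R, F) + ?t (R, insert (c, i) F))"
        by simp
    qed
    also have "(\<Sum>(R, F)\<in>placements ?B.
       ?t (R, F) + (\<Sum>i\<in>?D - snd ` R. ?t (insert (c, i) R, F) + ?t (R, insert (c, i) F))) =
       sum ?t (placements ?B')"
      by (rule sum_placements_add_column[OF B fin, symmetric]) simp
    finally show ?thesis by (simp add: LX)
  qed
qed

text \<open>Collects the placements by their numbers of rooks and files; the row and column bounds
  give the range of \<open>k\<close> and \<open>l\<close>.\<close>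

lemma word_cong_sum_mixed_numbers:
  fixes w :: "letter list"
  defines "N \<equiv> count_list w LY" and "M \<equiv> count_list w LX"
  shows "foldr (\<lambda>a p. free_gen a * p) w 1 \<approx>
    (\<Sum>k\<in>{0..min M N}. \<Sum>l\<in>{0..M - k}. ordered N M (mixed_number mu nu q k l (board w)) k l)"
proof -
  let ?B = "board w"
  let ?t = "\<lambda>\<phi>. ordered N M (weight ?B \<phi>) (card (fst \<phi>)) (card (snd \<phi>))"
  let ?g = "\<lambda>\<phi>::cell set \<times> cell set. (card (fst \<phi>), card (snd \<phi>))"
  let ?K = "Sigma {0..min M N} (\<lambda>k. {0..M - k})"
  have fin: "finite ?B" by (simp add: board_eq_board_from finite_board_from)
  have sub: "?B \<subseteq> {0..<M} \<times> {0..<N}"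
    using board_from_subset[of 0 0 w] by (simp add: board_eq_board_from M_def N_def)
  have g: "?g ` placements ?B \<subseteq> ?K"
    using placements_card_rows[OF _ sub] placements_card_columns[OF _ sub _ fin] by fastforce
  have "foldr (\<lambda>a p. free_gen a * p) w 1 \<approx> sum ?t (placements ?B)"
    using word_cong_sum_placements[of w 0 0] by (simp add: board_eq_board_from M_def N_def)
  also have "sum ?t (placements ?B) = (\<Sum>x\<in>?K. sum ?t {\<phi> \<in> placements ?B. ?g \<phi> = x})"
    by (rule sum.group[symmetric]) (use fin g finite_placements in auto)
  also have "\<dots> = (\<Sum>(k, l)\<in>?K. ordered N M (mixed_number mu nu q k l ?B) k l)"
  proof (intro sum.cong refl, clarify)
    fix k l
    have "sum ?t {\<phi> \<in> placements ?B. ?g \<phi> = (k, l)} =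
        (\<Sum>\<phi>\<in>mixed_placements k l ?B.
          ordered N M (mu ^ k * nu ^ l * q ^ card (empty_boxes ?B \<phi>)) k l)"
      by (rule sum.cong) (auto simp: mixed_placements_eq weight_def)
    \<comment> \<open>Within a group the monomial is fixed, so the weights add up inside
      \<open>free_scalar\<close>.\<close>
    also have "\<dots> = ordered N M (mixed_number mu nu q k l ?B) k l"
      by (simp add: ordered_def mixed_number_def sum_distrib_left free_scalar_sum sum_distrib_right)
    finally show "sum ?t {\<phi> \<in> placements ?B. ?g \<phi> = (k, l)} =
        ordered N M (mixed_number mu nu q k l ?B) k l" .
  qed
  also have "\<dots> = (\<Sum>k\<in>{0..min M N}. \<Sum>l\<in>{0..M - k}.
      ordered N M (mixed_number mu nu q k l ?B) k l)"
    by (rule sum.Sigma[symmetric]) auto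
  finally show ?thesis .
qed

text \<open>Carries the congruence into the quotient: the class map respects sums, products and
  powers.\<close>

lemma ore_word_expansion:
  fixes w :: "letter list"
  defines "A \<equiv> ore_algebra mu nu q"
    and "N \<equiv> count_list w LY" and "M \<equiv> count_list w LX"
  shows "ore_word mu nu q w =
    (\<Oplus>\<^bsub>A\<^esub>k\<in>{0..min M N}. \<Oplus>\<^bsub>A\<^esub>l\<in>{0..M - k}.
       ore_scalar mu nu q (mixed_number mu nu q k l (board w)) \<otimes>\<^bsub>A\<^esub>
       (ore_gen mu nu q LY [^]\<^bsub>A\<^esub> (N - k) \<otimes>\<^bsub>A\<^esub> ore_gen mu nu q LX [^]\<^bsub>A\<^esub> (M - k - l)))"
  unfolding ore_word_eq word_cong_sum_mixed_numbers
  by (simp add: ore_class_sum ordered_def ore_class_mult ore_class_power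
      ore_scalar_def ore_gen_def A_def N_def M_def)

end

section \<open>Letter counts of block words\<close>

lemma count_list_replicate: "count_list (replicate k a) b = (if a = b then k else 0)"
  by (induction k) auto

lemma count_list_block_word:
  "count_list (block_word r n m) LY = (\<Sum>j=1..r. n j)"
  "count_list (block_word r n m) LX = (\<Sum>j=1..r. m j)"
  by (induction r) (auto simp: block_word_def count_list_replicate)

theorem theorem2p6:
  fixes mu nu q :: complex and r :: nat and n m :: "nat \<Rightarrow> nat"
  defines "A \<equiv> ore_algebra mu nu q"
    and "w \<equiv> block_word r n m"
    and "N \<equiv> (\<Sum>j=1..r. n j)"
    and "M \<equiv> (\<Sum>j=1..r. m j)"
  shows "ore_word mu nu q w =
    (\<Oplus>\<^bsub>A\<^esub>k\<in>{0..min M N}. \<Oplus>\<^bsub>A\<^esub>l\<in>{0..M - k}.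
       ore_scalar mu nu q (mixed_number mu nu q k l (board w)) \<otimes>\<^bsub>A\<^esub>
       (ore_gen mu nu q LY [^]\<^bsub>A\<^esub> (N - k) \<otimes>\<^bsub>A\<^esub> ore_gen mu nu q LX [^]\<^bsub>A\<^esub> (M - k - l)))"
  using ore_word_expansion[of mu nu q w]
  by (simp add: A_def w_def N_def M_def count_list_block_word)

end
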